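(* Let $q=3^{2h+1}$ with $h\ge 0$ an integer, and let $\alpha=\sqrt{3q}=3^{h+1}$. For all $a\in GF(q)$, the polynomial $f_a(x):=x^{2\alpha+3}+(a x)^{\alpha} - a^2 x$ is a permutation polynomial over $GF(q)$.
   Context: A polynomial over $GF(q)$ is a permutation polynomial if the map $x\mapsto f(x)$ is a bijection of $GF(q)$. *)

theory Defs
  imports Complex_Main "HOL-Library.Cardinality" "HOL-Computational_Algebra.Polynomial"
begin

text \<open>
  \<open>GF(q)\<close> is represented by an arbitrary type of sort \<open>{field, finite}\<close> with \<open>CARD('a) = q\<close>.
\<close>

definition permutation_polynomial :: "'a::{field,finite} poly \<Rightarrow> bool" where
  "permutation_polynomial f \<longleftrightarrow> bij (poly f)"

definition f_poly :: "nat \<Rightarrow> 'a::{field,finite} \<Rightarrow> 'a poly" where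
  "f_poly \<alpha> a = monom 1 (2 * \<alpha> + 3) + (smult a (monom 1 1)) ^ \<alpha> - smult (a\<^sup>2) (monom 1 1)"

lemma poly_f_poly: "poly (f_poly \<alpha> a) x = x ^ (2 * \<alpha> + 3) + (a * x) ^ \<alpha> - a\<^sup>2 * x"
  by (simp add: f_poly_def poly_monom)

lemma sqrt_3q: "sqrt (real (3 * 3 ^ (2 * h + 1))) = real (3 ^ (h + 1))"
proof -
  have "real (3 * 3 ^ (2 * h + 1)) = (real (3 ^ (h + 1)))\<^sup>2"
    by (simp add: power2_eq_square power_add mult_2)
  then show ?thesis
    by (simp only: real_sqrt_abs abs_of_nat)
qed

end

theory Submission
  imports Defs "HOL-Computational_Algebra.Primes"
begin

text \<open>
  The map \<open>\<sigma> x = x ^ \<alpha>\<close> is a field automorphism with \<open>\<sigma> (\<sigma> x) = x ^ 3\<close>, and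
  \<open>f\<^sub>a x = (\<sigma> x)\<^sup>2 * x ^ 3 + \<sigma> a * \<sigma> x - a\<^sup>2 * x\<close>. If \<open>f\<^sub>a x = f\<^sub>a y\<close> with \<open>d = x - y \<noteq> 0\<close>, put
  \<open>r = (x + y) / d\<close> and \<open>p = a / (d * \<sigma> d)\<close>. With \<open>R = \<sigma> r\<close> and \<open>k = r ^ 3 = \<sigma> R\<close>, the equation
  becomes \<open>\<sigma> p = p\<^sup>2 - (R\<^sup>2 + 1 - R * k)\<close>. Applying \<open>\<sigma>\<close> and eliminating \<open>\<sigma> p\<close> gives a quartic
  in \<open>p\<close>, which in characteristic 3 is the product of
  \<open>p\<^sup>2 + (1 + R) * p + (R + k) * (1 + R)\<close> and its image under \<open>r \<mapsto> -r\<close>. When the first factor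
  vanishes, \<open>\<sigma> p\<close> is linear in \<open>p\<close>; applying \<open>\<sigma>\<close> once more gives an equation linear in \<open>p\<close>,
  and eliminating \<open>p\<close> leaves \<open>(R + k) ^ 3 * (R ^ 3 + k) = 0\<close>. This forces \<open>r = 0\<close>, which is
  impossible.
\<close>

locale sqrt_frobenius3 =
  fixes \<sigma> :: "'a::field \<Rightarrow> 'a"
  assumes three_eq_0: "(3::'a) = 0"
    and add: "\<sigma> (x + y) = \<sigma> x + \<sigma> y"
    and mult: "\<sigma> (x * y) = \<sigma> x * \<sigma> y"
    and twice: "\<sigma> (\<sigma> x) = x ^ 3"
begin

lemma zero [simp]: "\<sigma> 0 = 0"
  by (metis add add_cancel_right_right)

lemma one [simp]: "\<sigma> 1 = 1"
  using mult[of 1 1] twice[of 1] by (cases "\<sigma> 1 = 0") auto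

lemma minus: "\<sigma> (- x) = - \<sigma> x"
  using add[of x "- x"] by (simp add: eq_neg_iff_add_eq_0 add.commute)

lemma diff: "\<sigma> (x - y) = \<sigma> x - \<sigma> y"
  using add[of x "- y"] by (simp add: minus)

lemma power: "\<sigma> (x ^ n) = \<sigma> x ^ n"
  by (induction n) (simp_all add: mult)

lemmas hom = add mult diff minus power twice

text \<open>
  In an identity modulo 3 the multiple of 3 is exhibited as \<open>3 * c\<close>, since the normalisation of
  ring expressions works over the integers.
\<close>
lemma eq_mod3: "x = y + 3 * c \<Longrightarrow> x = (y::'a)"
  by (simp add: three_eq_0)

text \<open>This settles the case \<open>r = 0\<close>: \<open>p\<close> is \<open>0\<close> or
  \<open>- 1\<close>, both fixed by \<open>\<sigma>\<close>, whereas \<open>p\<^sup>2 - 1\<close>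
  interchanges them.\<close>

lemma no_solution_zero: "\<sigma> p \<noteq> p\<^sup>2 - 1" if "p\<^sup>2 + p = 0"
proof -
  have "p * (p + 1) = 0"
    using that by (simp add: algebra_simps power2_eq_square)
  then have "p = 0 \<or> p = - 1"
    by (simp add: eq_neg_iff_add_eq_0)
  then show ?thesis
    by (auto simp: minus)
qed

text \<open>Additivity of cubing gives \<open>\<sigma> r = - r\<close>, hence
  \<open>r ^ 3 = r\<close>; so \<open>r\<close> lies in the prime field, which
  \<open>\<sigma>\<close> fixes.\<close>

lemma eq_0_of_neg_cube:
  assumes "r ^ 3 = - (\<sigma> r ^ 3)"
  shows "r = 0"
proof -
  have "(\<sigma> r + r) ^ 3 = \<sigma> r ^ 3 + r ^ 3"
    by (rule eq_mod3[where c = "(\<sigma> r)\<^sup>2 * r + \<sigma> r * r\<^sup>2"]) algebra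
  then have "(\<sigma> r + r) ^ 3 = 0"
    by (simp add: assms)
  then have R: "\<sigma> r = - r"
    by (simp add: eq_neg_iff_add_eq_0)
  then have "r ^ 3 = r"
    using twice[of r] by (simp add: minus)
  then have "r * ((r - 1) * (r + 1)) = 0"
    by (simp add: algebra_simps power3_eq_cube)
  then have "r = 0 \<or> r = 1 \<or> r = - 1"
    by (simp add: eq_neg_iff_add_eq_0)
  then have "\<sigma> r = r"
    by (auto simp: minus)
  with R have "r = - r"
    by simp
  moreover have "2 * r = - r"
    by (rule eq_mod3[where c = r]) algebra
  ultimately show ?thesis
    by (metis add_cancel_right_right mult_2)
qed

lemma first_factor_nonzero:
  assumes P: "\<sigma> p = p\<^sup>2 - ((\<sigma> r)\<^sup>2 + 1 - \<sigma> r * r ^ 3)"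
  shows "p\<^sup>2 + (1 + \<sigma> r) * p + (\<sigma> r + r ^ 3) * (1 + \<sigma> r) \<noteq> 0"
proof
  define R k where Rk: "R = \<sigma> r" "k = r ^ 3"
  have \<sigma>R: "\<sigma> R = k" and \<sigma>k: "\<sigma> k = R ^ 3"
    by (simp_all add: Rk hom)
  \<comment> \<open>\<open>N\<close> is, modulo 3, what remains besides the term
    \<open>(1 + R) * k * p\<close> once \<open>p ^ 3\<close> is reduced by the quadratic
    \<open>F\<close>.\<close>
  define N where "N = (1 + R) ^ 3 + (1 + R)\<^sup>2 * k - (k - 1)\<^sup>2"
  assume "p\<^sup>2 + (1 + \<sigma> r) * p + (\<sigma> r + r ^ 3) * (1 + \<sigma> r) = 0"
  then have F: "p\<^sup>2 + (1 + R) * p + (R + k) * (1 + R) = 0"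
    by (simp add: Rk)
  have P': "\<sigma> p = p\<^sup>2 - (R\<^sup>2 + 1 - R * k)"
    using P by (simp add: Rk)
  have lin: "\<sigma> p = R\<^sup>2 - R - 1 - k - (1 + R) * p"
    by (rule eq_mod3[where c = "- (R\<^sup>2)"]) (use P' F in algebra)
  then have "\<sigma> (\<sigma> p) = \<sigma> (R\<^sup>2 - R - 1 - k - (1 + R) * p)"
    by simp
  then have "p ^ 3 = k\<^sup>2 - k - 1 - R ^ 3 - (1 + k) * \<sigma> p"
    by (simp add: hom \<sigma>R \<sigma>k)
  then have cube: "p ^ 3 = k\<^sup>2 - k - 1 - R ^ 3 - (1 + k) * (R\<^sup>2 - R - 1 - k - (1 + R) * p)"
    by (simp only: lin)
  have N: "N = (1 + R) * k * p"
    unfolding N_def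
    by (rule eq_mod3[where c = "- p*R*k - p*k + R^3 + R^2*k + 2*R^2 + R*k + R - k^2 + k"])
      (use cube F in algebra)
  \<comment> \<open>Modulo 3, completing the square in \<open>F\<close> gives
    \<open>(p - (1 + R))\<^sup>2 = (1 + R) * (1 - k)\<close>; scaling by
    \<open>((1 + R) * k)\<^sup>2\<close> turns \<open>p\<close> into \<open>N\<close> without
    division.\<close>
  have sq: "(N - (1 + R)\<^sup>2 * k)\<^sup>2 = - ((1 + R) ^ 3 * k\<^sup>2 * (k - 1))"
    unfolding N
    by (rule eq_mod3[where c = "- p*R^3*k^2 - 3*p*R^2*k^2 - 3*p*R*k^2 - p*k^2"]) (use F in algebra)
  have "(R + k) ^ 3 * (R ^ 3 + k) = (N - (1 + R)\<^sup>2 * k)\<^sup>2 + (1 + R) ^ 3 * k\<^sup>2 * (k - 1)"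
    unfolding N_def
    by (rule eq_mod3[where c = "R^5*k - 2*R^5 + R^4*k^2 - 5*R^4 + R^3*k^2 - R^3*k - 6*R^3 - R^2*k^3
      + 4*R^2*k^2 - 4*R^2*k - 3*R^2 + 3*R*k^2 - 4*R*k + k^3 - k^2"]) algebra
  then have "(R + k) ^ 3 * (R ^ 3 + k) = 0"
    by (simp add: sq)
  then have "R = - k \<or> k = - (R ^ 3)"
    by (auto simp: eq_neg_iff_add_eq_0 add.commute)
  moreover have "k = - (R ^ 3)" if "R = - k"
    using arg_cong[OF that, of \<sigma>] by (simp add: \<sigma>R \<sigma>k minus)
  ultimately have "k = - (R ^ 3)"
    by blast
  then have "r = 0"
    using eq_0_of_neg_cube[of r] by (simp add: Rk)
  then show False
    using P F no_solution_zero[of p] by (simp add: Rk)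
qed

lemma no_solution: "\<sigma> p \<noteq> p\<^sup>2 - ((\<sigma> r)\<^sup>2 + 1 - \<sigma> r * r ^ 3)"
proof
  define R k where Rk: "R = \<sigma> r" "k = r ^ 3"
  assume P: "\<sigma> p = p\<^sup>2 - ((\<sigma> r)\<^sup>2 + 1 - \<sigma> r * r ^ 3)"
  then have P': "\<sigma> p = p\<^sup>2 - (R\<^sup>2 + 1 - R * k)"
    by (simp add: Rk)
  have \<sigma>: "\<sigma> R = k" "\<sigma> k = R ^ 3"
    by (simp_all add: Rk hom)
  have "\<sigma> (\<sigma> p) = \<sigma> (p\<^sup>2 - (R\<^sup>2 + 1 - R * k))"
    by (simp only: P')
  then have "p ^ 3 = (\<sigma> p)\<^sup>2 - (k\<^sup>2 + 1 - k * R ^ 3)"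
    by (simp add: hom \<sigma>)
  then have cube: "p ^ 3 = (p\<^sup>2 - (R\<^sup>2 + 1 - R * k))\<^sup>2 - (k\<^sup>2 + 1 - k * R ^ 3)"
    by (simp only: P')
  have "(p\<^sup>2 + (1 + R) * p + (R + k) * (1 + R)) * (p\<^sup>2 + (1 - R) * p - (R + k) * (1 - R)) = 0"
    by (rule eq_mod3[where c = "p^3 + p^2*R^2 + p^2 + R^3*k - R^2"]) (use cube in algebra)
  moreover have "p\<^sup>2 + (1 + R) * p + (R + k) * (1 + R) \<noteq> 0"
    using first_factor_nonzero[OF P] by (simp add: Rk)
  \<comment> \<open>The equation \<open>P\<close> is unchanged under \<open>r \<mapsto> - r\<close>,
    which negates both \<open>R\<close> and \<open>k\<close>.\<close>
  moreover have "p\<^sup>2 + (1 - R) * p - (R + k) * (1 - R) \<noteq> 0"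
    using first_factor_nonzero[of p "- r"] P by (simp add: Rk minus algebra_simps)
  ultimately show False
    by simp
qed

lemma inj_slice: "inj (\<lambda>x. (\<sigma> x)\<^sup>2 * x ^ 3 + \<sigma> a * \<sigma> x - a\<^sup>2 * x)"
proof (rule injI, rule ccontr)
  fix x y
  assume eq: "(\<sigma> x)\<^sup>2 * x ^ 3 + \<sigma> a * \<sigma> x - a\<^sup>2 * x = (\<sigma> y)\<^sup>2 * y ^ 3 + \<sigma> a * \<sigma> y - a\<^sup>2 * y"
    and "x \<noteq> y"
  define d where "d = x - y"
  with \<open>x \<noteq> y\<close> have d: "d \<noteq> 0"
    by simp
  have \<sigma>d: "\<sigma> d \<noteq> 0"
    using twice[of d] d by auto
  \<comment> \<open>In characteristic 3 this is \<open>(x + y) / d\<close>.\<close>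
  define r where "r = - 1 - x / d"
  define p where "p = a / (d * \<sigma> d)"
  have x: "x = - (r + 1) * d" and a: "a = p * d * \<sigma> d"
    using d \<sigma>d by (simp_all add: r_def p_def)
  have y: "y = - (r + 2) * d"
    using x by (simp add: d_def algebra_simps)
  have "\<sigma> 2 = 2"
    using add[of 1 1] by simp
  then have \<sigma>: "\<sigma> x = - (\<sigma> r + 1) * \<sigma> d" "\<sigma> y = - (\<sigma> r + 2) * \<sigma> d" "\<sigma> a = \<sigma> p * \<sigma> d * d ^ 3"
    by (simp_all only: x y a hom one)
  have "(\<sigma> d)\<^sup>2 * d ^ 3 * (\<sigma> p - (p\<^sup>2 - ((\<sigma> r)\<^sup>2 + 1 - \<sigma> r * r ^ 3))) = 0"
    by (rule eq_mod3[where c = "- ((\<sigma> d)\<^sup>2 * d ^ 3 * ((\<sigma> r + 1) * r ^ 3 + ((\<sigma> r)\<^sup>2 + 6 * \<sigma> r + 7) * r\<^sup>2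
        + (3 * (\<sigma> r)\<^sup>2 + 14 * \<sigma> r + 15) * r + 2 * (\<sigma> r)\<^sup>2 + 10 * \<sigma> r + 10))"])
      (use eq[unfolded \<sigma>, unfolded x y a] in algebra)
  then show False
    using no_solution d \<sigma>d by simp
qed

end

text \<open>Multiplication by a nonzero \<open>x\<close> permutes the nonzero elements, so their
  product absorbs a power of \<open>x\<close>.\<close>

lemma power_CARD_eq_same:
  fixes x :: "'a::{field,finite}"
  shows "x ^ CARD('a) = x"
proof (cases "x = 0")
  case False
  let ?U = "UNIV - {0::'a}"
  have "(\<Prod>y\<in>?U. y) = (\<Prod>y\<in>?U. x * y)"
    by (rule prod.reindex_bij_witness[of _ "\<lambda>y. x * y" "\<lambda>y. y / x"]) (use False in auto)
  also have "\<dots> = x ^ card ?U * (\<Prod>y\<in>?U. y)"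
    by (simp add: prod.distrib)
  finally have "x ^ card ?U = 1"
    by simp
  then show ?thesis
    by (simp add: card_Diff_singleton power_eq_if)
qed simp

text \<open>Translation by \<open>1\<close> permutes the field, so comparing sums over all elements
  shows that \<open>p ^ n\<close> vanishes in it.\<close>

lemma CHAR_eq_of_CARD_prime_power:
  assumes "CARD('a::{field,finite}) = p ^ n" and "prime p"
  shows "CHAR('a) = p"
proof -
  have "prime CHAR('a)"
    by (intro prime_CHAR_semidom finite_imp_CHAR_pos) simp
  moreover have "CHAR('a) dvd p ^ n"
  proof -
    have "(\<Sum>x\<in>UNIV. x) = (\<Sum>x\<in>UNIV. x + (1::'a))"
      by (rule sum.reindex_bij_witness[of _ "\<lambda>x. x + 1" "\<lambda>x. x - 1"]) auto
    also have "\<dots> = (\<Sum>x\<in>UNIV. x) + of_nat (p ^ n)"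
      by (simp add: sum.distrib flip: assms(1))
    finally have "of_nat (p ^ n) = (0::'a)"
      by (metis add_cancel_right_right)
    then show ?thesis
      by (simp only: of_nat_eq_0_iff_char_dvd)
  qed
  ultimately show ?thesis
    using assms(2) prime_dvd_power primes_dvd_imp_eq by blast
qed

theorem theorem2:
  fixes h q \<alpha> :: nat and a :: "'a::{field,finite}"
  assumes "q = 3 ^ (2 * h + 1)"
    and "CARD('a) = q"
    and "\<alpha> = 3 ^ (h + 1)"
  shows "permutation_polynomial (f_poly \<alpha> a)"
proof -
  have char: "CHAR('a) = 3"
    using assms by (intro CHAR_eq_of_CARD_prime_power[of _ "2 * h + 1"]) auto
  interpret sqrt_frobenius3 "\<lambda>x::'a. x ^ \<alpha>"
  proof
    show "(3::'a) = 0"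
      using of_nat_CHAR[where 'a = 'a] by (simp add: char)
  next
    fix x y :: 'a
    show "(x + y) ^ \<alpha> = x ^ \<alpha> + y ^ \<alpha>"
      by (rule freshmans_dream'[where n = "h + 1"]) (simp_all add: char assms(3))
    show "(x * y) ^ \<alpha> = x ^ \<alpha> * y ^ \<alpha>"
      by (rule power_mult_distrib)
    have "\<alpha> * \<alpha> = CARD('a) * 3"
      by (simp add: assms mult_2 power_add)
    then have "(x ^ \<alpha>) ^ \<alpha> = (x ^ CARD('a)) ^ 3"
      by (simp flip: power_mult)
    then show "(x ^ \<alpha>) ^ \<alpha> = x ^ 3"
      by (simp add: power_CARD_eq_same)
  qed
  have "poly (f_poly \<alpha> a) = (\<lambda>x. (x ^ \<alpha>)\<^sup>2 * x ^ 3 + a ^ \<alpha> * x ^ \<alpha> - a\<^sup>2 * x)"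
    by (rule ext) (simp add: poly_f_poly power_add power_mult_distrib mult.commute[of 2] power_mult)
  then have "inj (poly (f_poly \<alpha> a))"
    using inj_slice[of a] by simp
  then show ?thesis
    unfolding permutation_polynomial_def bij_def by (simp add: finite_UNIV_inj_surj)
qed

end
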